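(* Let $(M,\nabla,P,g)$ be a para-Kähler-like statistical manifold of dimension $n\neq 2$. If $M$ is a space of constant curvature in the Kurose's sense, then the statistical structure $(\nabla,g)$ is a Hessian structure.
   Context: Let $(M,g)$ be a semi-Riemannian manifold. For an affine connection $\nabla$ on $M$, its curvature tensor field is $R(E,F)G=\nabla_E\nabla_FG-\nabla_F\nabla_EG-\nabla_{[E,F]}G$. The pair $(\nabla,g)$ is a statistical structure on $M$ if $\nabla$ is torsion-free and the covariant derivative $\nabla g$ is symmetric, i.e. $(\nabla_E g)(F,G)=(\nabla_F g)(E,G)$ for all vector fields $E,F,G$; then $(M,\nabla,g)$ is called a statistical manifold. A statistical structure $(\nabla,g)$ is a Hessian structure if $\nabla$ is flat, i.e. $R$ vanishes identically. The statistical manifold $(M,\nabla,g)$ is a space of constant curvature in the Kurose's sense if there is a real constant $k$ such that $R(E,F)G=k\{g(F,G)E-g(E,G)F\}$ for all vector fields $E,F,G$ on $M$. An almost product structure on a smooth manifold $M$ is a tensor field $P$ of type $(1,1)$ on $M$ with $P\neq\pm\mathrm{Id}$ and $P^2=\mathrm{Id}$. If $P$ is an almost product structure on a semi-Riemannian manifold $(M,g)$, the triple $(M,P,g)$ is called an almost para-Hermitian-like manifold; one denotes by $P^*$ the $(1,1)$-tensor field determined by $g(PE,F)+g(E,P^*F)=0$ (the negative of the adjoint of $P$, which always exists). If $(M,P,g)$ is an almost para-Hermitian-like manifold and $(\nabla,g)$ is a statistical structure on $M$ such that $P$ is parallel with respect to $\nabla$ (i.e. $\nabla P=0$), then $(M,\nabla,P,g)$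 is called a para-Kähler-like statistical manifold.
   Formalization: The condition P ≠ ±Id is required on some connected component of M (the same as stated when M is connected); on a disconnected M, P = Id on one round 3-sphere and −Id on another, with the Levi-Civita connection, is a counterexample to the literal claim. *)

theory Defs
  imports "HOL-Analysis.Analysis"
begin

section \<open>Smooth maps between open subsets of Euclidean spaces\<close>

primrec Ck_on :: "nat \<Rightarrow> ('a::euclidean_space \<Rightarrow> 'b::real_normed_vector) \<Rightarrow> 'a set \<Rightarrow> bool" where
  "Ck_on 0 f S \<longleftrightarrow> continuous_on S f"
| "Ck_on (Suc k) f S \<longleftrightarrow>
     (\<forall>x\<in>S. f differentiable (at x)) \<and>
     (\<forall>v. Ck_on k (\<lambda>x. frechet_derivative f (at x) v) S)"

text \<open>Meant for open \<open>S\<close> only; then the values of \<open>f\<close> off \<open>S\<close> are irrelevant.\<close>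

definition smooth_on :: "('a::euclidean_space \<Rightarrow> 'b::real_normed_vector) \<Rightarrow> 'a set \<Rightarrow> bool" where
  "smooth_on f S \<longleftrightarrow> (\<forall>k. Ck_on k f S)"


section \<open>Smooth manifolds\<close>

text \<open>
  The manifold is the whole of a Hausdorff, second countable type \<open>'m\<close>, modelled on a Euclidean
  space \<open>'a\<close>, so that its dimension is \<open>DIM('a)\<close>. The smooth structure is given by an
  atlas, which need not be maximal. A chart is a pair of a domain and a coordinate map, whose
  values off the domain are irrelevant.
\<close>

type_synonym ('m, 'a) chart = "'m set \<times> ('m \<Rightarrow> 'a)"

definition chart_inv :: "('m, 'a) chart \<Rightarrow> 'a \<Rightarrow> 'm" where
  "chart_inv c = inv_into (fst c) (snd c)"

definition chart_range :: "('m, 'a) chart \<Rightarrow> 'a set" where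
  "chart_range c = snd c ` fst c"

definition is_chart :: "('m::topological_space, 'a::euclidean_space) chart \<Rightarrow> bool" where
  "is_chart c \<longleftrightarrow> open (fst c) \<and> open (chart_range c) \<and>
     homeomorphism (fst c) (chart_range c) (snd c) (chart_inv c)"

definition smooth_atlas ::
  "('m::{t2_space,second_countable_topology}, 'a::euclidean_space) chart set \<Rightarrow> bool" where
  "smooth_atlas A \<longleftrightarrow>
     (\<forall>c\<in>A. is_chart c) \<and> (\<Union>c\<in>A. fst c) = UNIV \<and>
     (\<forall>c\<in>A. \<forall>d\<in>A. smooth_on (snd d \<circ> chart_inv c) (snd c ` (fst c \<inter> fst d)))"

definition smooth_function ::
  "('m::topological_space, 'a::euclidean_space) chart set \<Rightarrow> ('m \<Rightarrow> real) \<Rightarrow> bool" where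
  "smooth_function A f \<longleftrightarrow> (\<forall>c\<in>A. smooth_on (f \<circ> chart_inv c) (chart_range c))"


section \<open>Tangent vectors and vector fields\<close>

text \<open>
  The tangent space at \<open>p\<close> is represented by \<open>'a\<close> through the coordinates of one chart around
  \<open>p\<close>, chosen once and for all: \<open>v :: 'a\<close> stands for the tangent vector at \<open>p\<close> whose components
  in the chart \<open>chart_at A p\<close> are \<open>v\<close>. Its components in any other chart \<open>c\<close> around \<open>p\<close> are
  given by the usual transformation law, through \<open>components_in A c p\<close>. The chosen chart may
  change abruptly with \<open>p\<close>, so smoothness of a field is expressed by its components in each fixed
  chart of the atlas.
\<close>

definition chart_at :: "('m, 'a) chart set \<Rightarrow> 'm \<Rightarrow> ('m, 'a) chart" where
  "chart_at A p = (SOME c. c \<in> A \<and> p \<in> fst c)"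

definition components_in ::
  "('m, 'a::euclidean_space) chart set \<Rightarrow> ('m, 'a) chart \<Rightarrow> 'm \<Rightarrow> 'a \<Rightarrow> 'a" where
  "components_in A c p v =
     frechet_derivative (snd c \<circ> chart_inv (chart_at A p)) (at (snd (chart_at A p) p)) v"

definition local_rep ::
  "('m, 'a::euclidean_space) chart set \<Rightarrow> ('m, 'a) chart \<Rightarrow> ('m \<Rightarrow> 'a) \<Rightarrow> 'a \<Rightarrow> 'a" where
  "local_rep A c E x = components_in A c (chart_inv c x) (E (chart_inv c x))"

definition vector_field ::
  "('m::topological_space, 'a::euclidean_space) chart set \<Rightarrow> ('m \<Rightarrow> 'a) \<Rightarrow> bool" where
  "vector_field A E \<longleftrightarrow> (\<forall>c\<in>A. smooth_on (local_rep A c E) (chart_range c))"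

text \<open>The function \<open>E f\<close>.\<close>

definition deriv_along ::
  "('m, 'a::euclidean_space) chart set \<Rightarrow> ('m \<Rightarrow> 'a) \<Rightarrow> ('m \<Rightarrow> real) \<Rightarrow> 'm \<Rightarrow> real" where
  "deriv_along A E f p =
     frechet_derivative (f \<circ> chart_inv (chart_at A p)) (at (snd (chart_at A p) p)) (E p)"

text \<open>
  The bracket \<open>[E, F]\<close>, by the coordinate formula \<open>[E, F]\<^sup>i = E\<^sup>j \<partial>\<^sub>j F\<^sup>i - F\<^sup>j \<partial>\<^sub>j E\<^sup>i\<close>
  in the chart chosen at \<open>p\<close>, where the components of \<open>E\<close> at \<open>p\<close> are \<open>E p\<close>.
\<close>

definition lie_bracket ::
  "('m, 'a::euclidean_space) chart set \<Rightarrow> ('m \<Rightarrow> 'a) \<Rightarrow> ('m \<Rightarrow> 'a) \<Rightarrow> 'm \<Rightarrow> 'a" where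
  "lie_bracket A E F p =
     (let c = chart_at A p; x = snd c p in
        frechet_derivative (local_rep A c F) (at x) (E p) -
        frechet_derivative (local_rep A c E) (at x) (F p))"


section \<open>Tensor fields\<close>

text \<open>
  Smoothness of a tensor field is expressed by its taking smooth vector fields to smooth vector
  fields or smooth functions.
\<close>

definition tensor_field_11 ::
  "('m::topological_space, 'a::euclidean_space) chart set \<Rightarrow> ('m \<Rightarrow> 'a \<Rightarrow> 'a) \<Rightarrow> bool" where
  "tensor_field_11 A P \<longleftrightarrow>
     (\<forall>p. linear (P p)) \<and>
     (\<forall>E. vector_field A E \<longrightarrow> vector_field A (\<lambda>p. P p (E p)))"

definition tensor_field_02 ::
  "('m::topological_space, 'a::euclidean_space) chart set \<Rightarrow> ('m \<Rightarrow> 'a \<Rightarrow> 'a \<Rightarrow> real) \<Rightarrow> bool" where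
  "tensor_field_02 A g \<longleftrightarrow>
     (\<forall>p. bilinear (g p)) \<and>
     (\<forall>E F. vector_field A E \<longrightarrow> vector_field A F \<longrightarrow> smooth_function A (\<lambda>p. g p (E p) (F p)))"

definition form_index :: "('a::euclidean_space \<Rightarrow> 'a \<Rightarrow> real) \<Rightarrow> nat" where
  "form_index b = Max {dim W | W. subspace W \<and> (\<forall>w\<in>W. w \<noteq> 0 \<longrightarrow> b w w < 0)}"

definition semi_riemannian_metric ::
  "('m::topological_space, 'a::euclidean_space) chart set \<Rightarrow> ('m \<Rightarrow> 'a \<Rightarrow> 'a \<Rightarrow> real) \<Rightarrow> bool" where
  "semi_riemannian_metric A g \<longleftrightarrow>
     tensor_field_02 A g \<and>
     (\<forall>p v w. g p v w = g p w v) \<and>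
     (\<forall>p v. (\<forall>w. g p v w = 0) \<longrightarrow> v = 0) \<and>
     (\<exists>\<nu>. \<forall>p. form_index (g p) = \<nu>)"

definition semi_riemannian_manifold ::
  "('m::{t2_space,second_countable_topology}, 'a::euclidean_space) chart set \<Rightarrow>
   ('m \<Rightarrow> 'a \<Rightarrow> 'a \<Rightarrow> real) \<Rightarrow> bool" where
  "semi_riemannian_manifold A g \<longleftrightarrow> smooth_atlas A \<and> semi_riemannian_metric A g"


section \<open>Affine connections and statistical structures\<close>

definition affine_connection ::
  "('m::topological_space, 'a::euclidean_space) chart set \<Rightarrow>
   (('m \<Rightarrow> 'a) \<Rightarrow> ('m \<Rightarrow> 'a) \<Rightarrow> 'm \<Rightarrow> 'a) \<Rightarrow> bool" where
  "affine_connection A D \<longleftrightarrow>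
     (\<forall>E F. vector_field A E \<longrightarrow> vector_field A F \<longrightarrow> vector_field A (D E F)) \<and>
     (\<forall>E E' F. vector_field A E \<longrightarrow> vector_field A E' \<longrightarrow> vector_field A F \<longrightarrow>
        D (\<lambda>p. E p + E' p) F = (\<lambda>p. D E F p + D E' F p)) \<and>
     (\<forall>f E F. smooth_function A f \<longrightarrow> vector_field A E \<longrightarrow> vector_field A F \<longrightarrow>
        D (\<lambda>p. f p *\<^sub>R E p) F = (\<lambda>p. f p *\<^sub>R D E F p)) \<and>
     (\<forall>E F F'. vector_field A E \<longrightarrow> vector_field A F \<longrightarrow> vector_field A F' \<longrightarrow>
        D E (\<lambda>p. F p + F' p) = (\<lambda>p. D E F p + D E F' p)) \<and>
     (\<forall>f E F. smooth_function A f \<longrightarrow> vector_field A E \<longrightarrow> vector_field A F \<longrightarrow>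
        D E (\<lambda>p. f p *\<^sub>R F p) = (\<lambda>p. deriv_along A E f p *\<^sub>R F p + f p *\<^sub>R D E F p))"

definition torsion_free ::
  "('m::topological_space, 'a::euclidean_space) chart set \<Rightarrow>
   (('m \<Rightarrow> 'a) \<Rightarrow> ('m \<Rightarrow> 'a) \<Rightarrow> 'm \<Rightarrow> 'a) \<Rightarrow> bool" where
  "torsion_free A D \<longleftrightarrow>
     (\<forall>E F. vector_field A E \<longrightarrow> vector_field A F \<longrightarrow>
        (\<forall>p. D E F p - D F E p - lie_bracket A E F p = 0))"

definition curvature ::
  "('m, 'a::euclidean_space) chart set \<Rightarrow> (('m \<Rightarrow> 'a) \<Rightarrow> ('m \<Rightarrow> 'a) \<Rightarrow> 'm \<Rightarrow> 'a) \<Rightarrow>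
   ('m \<Rightarrow> 'a) \<Rightarrow> ('m \<Rightarrow> 'a) \<Rightarrow> ('m \<Rightarrow> 'a) \<Rightarrow> 'm \<Rightarrow> 'a" where
  "curvature A D E F G p = D E (D F G) p - D F (D E G) p - D (lie_bracket A E F) G p"

definition flat ::
  "('m::topological_space, 'a::euclidean_space) chart set \<Rightarrow>
   (('m \<Rightarrow> 'a) \<Rightarrow> ('m \<Rightarrow> 'a) \<Rightarrow> 'm \<Rightarrow> 'a) \<Rightarrow> bool" where
  "flat A D \<longleftrightarrow>
     (\<forall>E F G. vector_field A E \<longrightarrow> vector_field A F \<longrightarrow> vector_field A G \<longrightarrow>
        (\<forall>p. curvature A D E F G p = 0))"

text \<open>The covariant derivatives \<open>(\<nabla>\<^sub>E g)(F, G)\<close> and \<open>(\<nabla>\<^sub>E P) F\<close>.\<close>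

definition cov_deriv_02 ::
  "('m, 'a::euclidean_space) chart set \<Rightarrow> (('m \<Rightarrow> 'a) \<Rightarrow> ('m \<Rightarrow> 'a) \<Rightarrow> 'm \<Rightarrow> 'a) \<Rightarrow>
   ('m \<Rightarrow> 'a \<Rightarrow> 'a \<Rightarrow> real) \<Rightarrow> ('m \<Rightarrow> 'a) \<Rightarrow> ('m \<Rightarrow> 'a) \<Rightarrow> ('m \<Rightarrow> 'a) \<Rightarrow> 'm \<Rightarrow> real" where
  "cov_deriv_02 A D g E F G p =
     deriv_along A E (\<lambda>q. g q (F q) (G q)) p - g p (D E F p) (G p) - g p (F p) (D E G p)"

definition cov_deriv_11 ::
  "(('m \<Rightarrow> 'a) \<Rightarrow> ('m \<Rightarrow> 'a) \<Rightarrow> 'm \<Rightarrow> 'a::euclidean_space) \<Rightarrow>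
   ('m \<Rightarrow> 'a \<Rightarrow> 'a) \<Rightarrow> ('m \<Rightarrow> 'a) \<Rightarrow> ('m \<Rightarrow> 'a) \<Rightarrow> 'm \<Rightarrow> 'a" where
  "cov_deriv_11 D P E F p = D E (\<lambda>q. P q (F q)) p - P p (D E F p)"

definition parallel_11 ::
  "('m::topological_space, 'a::euclidean_space) chart set \<Rightarrow>
   (('m \<Rightarrow> 'a) \<Rightarrow> ('m \<Rightarrow> 'a) \<Rightarrow> 'm \<Rightarrow> 'a) \<Rightarrow> ('m \<Rightarrow> 'a \<Rightarrow> 'a) \<Rightarrow> bool" where
  "parallel_11 A D P \<longleftrightarrow>
     (\<forall>E F. vector_field A E \<longrightarrow> vector_field A F \<longrightarrow> (\<forall>p. cov_deriv_11 D P E F p = 0))"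

definition statistical_structure ::
  "('m::topological_space, 'a::euclidean_space) chart set \<Rightarrow>
   (('m \<Rightarrow> 'a) \<Rightarrow> ('m \<Rightarrow> 'a) \<Rightarrow> 'm \<Rightarrow> 'a) \<Rightarrow> ('m \<Rightarrow> 'a \<Rightarrow> 'a \<Rightarrow> real) \<Rightarrow> bool" where
  "statistical_structure A D g \<longleftrightarrow>
     affine_connection A D \<and> torsion_free A D \<and>
     (\<forall>E F G. vector_field A E \<longrightarrow> vector_field A F \<longrightarrow> vector_field A G \<longrightarrow>
        (\<forall>p. cov_deriv_02 A D g E F G p = cov_deriv_02 A D g F E G p))"

definition hessian_structure ::
  "('m::topological_space, 'a::euclidean_space) chart set \<Rightarrow>
   (('m \<Rightarrow> 'a) \<Rightarrow> ('m \<Rightarrow> 'a) \<Rightarrow> 'm \<Rightarrow> 'a) \<Rightarrow> ('m \<Rightarrow> 'a \<Rightarrow> 'a \<Rightarrow> real) \<Rightarrow> bool" where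
  "hessian_structure A D g \<longleftrightarrow> statistical_structure A D g \<and> flat A D"

definition kurose_constant_curvature ::
  "('m::topological_space, 'a::euclidean_space) chart set \<Rightarrow>
   (('m \<Rightarrow> 'a) \<Rightarrow> ('m \<Rightarrow> 'a) \<Rightarrow> 'm \<Rightarrow> 'a) \<Rightarrow> ('m \<Rightarrow> 'a \<Rightarrow> 'a \<Rightarrow> real) \<Rightarrow> bool" where
  "kurose_constant_curvature A D g \<longleftrightarrow>
     (\<exists>k::real. \<forall>E F G. vector_field A E \<longrightarrow> vector_field A F \<longrightarrow> vector_field A G \<longrightarrow>
        (\<forall>p. curvature A D E F G p =
               k *\<^sub>R (g p (F p) (G p) *\<^sub>R E p - g p (E p) (G p) *\<^sub>R F p)))"


section \<open>Almost product structures and para-Kaehler-like statistical manifolds\<close>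

text \<open>
  The condition \<open>P \<noteq> \<plusminus>Id\<close> is required on some connected component. On a connected manifold this
  says exactly that \<open>P \<noteq> Id\<close> and \<open>P \<noteq> -Id\<close> as tensor fields; on a disconnected one it excludes
  in addition only the degenerate \<open>P\<close> that are \<open>Id\<close> on some components and \<open>-Id\<close> on all others.
\<close>

definition almost_product_structure ::
  "('m::topological_space, 'a::euclidean_space) chart set \<Rightarrow> ('m \<Rightarrow> 'a \<Rightarrow> 'a) \<Rightarrow> bool" where
  "almost_product_structure A P \<longleftrightarrow>
     tensor_field_11 A P \<and>
     (\<forall>p v. P p (P p v) = v) \<and>
     (\<exists>C \<in> components (UNIV :: 'm set).
        \<not> (\<forall>p\<in>C. \<forall>v. P p v = v) \<and> \<not> (\<forall>p\<in>C. \<forall>v. P p v = - v))"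

definition almost_para_hermitian_like_manifold ::
  "('m::{t2_space,second_countable_topology}, 'a::euclidean_space) chart set \<Rightarrow>
   ('m \<Rightarrow> 'a \<Rightarrow> 'a) \<Rightarrow> ('m \<Rightarrow> 'a \<Rightarrow> 'a \<Rightarrow> real) \<Rightarrow> bool" where
  "almost_para_hermitian_like_manifold A P g \<longleftrightarrow>
     semi_riemannian_manifold A g \<and> almost_product_structure A P"

definition para_kaehler_like_statistical_manifold ::
  "('m::{t2_space,second_countable_topology}, 'a::euclidean_space) chart set \<Rightarrow>
   (('m \<Rightarrow> 'a) \<Rightarrow> ('m \<Rightarrow> 'a) \<Rightarrow> 'm \<Rightarrow> 'a) \<Rightarrow> ('m \<Rightarrow> 'a \<Rightarrow> 'a) \<Rightarrow>
   ('m \<Rightarrow> 'a \<Rightarrow> 'a \<Rightarrow> real) \<Rightarrow> bool" where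
  "para_kaehler_like_statistical_manifold A D P g \<longleftrightarrow>
     almost_para_hermitian_like_manifold A P g \<and> statistical_structure A D g \<and> parallel_11 A D P"

end

theory Submission
  imports Defs
begin

text \<open>
  Let \<open>k\<close> be the constant of the curvature. If \<open>k = 0\<close>, the connection is flat, so suppose
  \<open>k \<noteq> 0\<close>. A parallel \<open>P\<close> commutes with the curvature, \<open>R(E, F)(P G) = P (R(E, F) G)\<close>
  (\<open>curvature_commutes_with_parallel\<close>). Inserting the form of the curvature and cancelling \<open>k\<close> gives,
  at every point and for all tangent vectors \<open>u\<close>, \<open>v\<close>, \<open>w\<close>,
  \<open>g(v, P w) u - g(u, P w) v = g(v, w) P u - g(u, w) P v\<close> (\<open>kurose_parallel_pointwise\<close>).

  At a point where \<open>P\<close> is neither \<open>Id\<close> nor \<open>-Id\<close>, both eigenspaces of \<open>P\<close> are nonzero. Taking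
  \<open>u\<close>, \<open>v\<close> from opposite eigenspaces shows that each eigenspace is isotropic; taking them from the
  same eigenspace and using that \<open>g\<close> is nondegenerate shows that they are proportional. So both
  eigenspaces are lines and the dimension is 2 (\<open>involution_identity_imp_dim_2\<close>). Where \<open>P = Id\<close> or
  \<open>P = -Id\<close> the identity says nothing, but \<open>k\<close> is the same at all points, so a single good point
  suffices. There is one, because otherwise \<open>P\<close> would be a continuous sign times \<open>Id\<close>, hence
  constantly \<open>Id\<close> or constantly \<open>-Id\<close> on every connected component
  (\<open>almost_product_nontrivial_somewhere\<close>).

  The hypotheses speak of vector fields and the linear algebra of tangent vectors. The bridge is
  that every tangent vector is the value of a smooth vector field on the whole manifold
  (\<open>ex_vector_field_through\<close>): a constant field in one chart is cut off by a bump function and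
  extended by zero. That the result is smooth in all other charts rests on the chain rule for
  \<open>Ck_on\<close>.
\<close>


section \<open>Calculus of continuously differentiable maps\<close>

lemma frechet_derivative_cong_open:
  assumes "open S" "x \<in> S" "\<And>y. y \<in> S \<Longrightarrow> f y = g y"
  shows "frechet_derivative f (at x) = frechet_derivative g (at x)"
proof -
  have "(f has_derivative f') (at x) \<longleftrightarrow> (g has_derivative f') (at x)" for f'
    using assms has_derivative_transform_within_open[of f f' x UNIV S g]
      has_derivative_transform_within_open[of g f' x UNIV S f] by auto
  then show ?thesis
    by (simp add: frechet_derivative_def)
qed

lemma differentiable_cong_open:
  assumes "open S" "x \<in> S" "\<And>y. y \<in> S \<Longrightarrow> f y = g y"
  shows "f differentiable (at x) \<longleftrightarrow> g differentiable (at x)"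
  unfolding differentiable_def
  using assms has_derivative_transform_within_open[of f _ x UNIV S g]
      has_derivative_transform_within_open[of g _ x UNIV S f] by metis

lemma Ck_on_cong:
  assumes "open S" "\<And>x. x \<in> S \<Longrightarrow> f x = g x"
  shows "Ck_on k f S \<longleftrightarrow> Ck_on k g S"
  using assms(2)
proof (induction k arbitrary: f g)
  case 0
  then show ?case by (simp cong: continuous_on_cong)
next
  case (Suc k)
  have "Ck_on k (\<lambda>x. frechet_derivative f (at x) v) S \<longleftrightarrow>
        Ck_on k (\<lambda>x. frechet_derivative g (at x) v) S" for v
    by (rule Suc.IH) (use frechet_derivative_cong_open[OF assms(1)] Suc.prems in metis)
  moreover have "f differentiable (at x) \<longleftrightarrow> g differentiable (at x)" if "x \<in> S" for x
    using differentiable_cong_open[OF assms(1) that] Suc.prems by metis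
  ultimately show ?case by auto
qed

text \<open>
  Derivatives are supplied here through \<open>has_derivative\<close>, which has a calculus, rather than through
  the choice-based \<open>frechet_derivative\<close> of the definition.
\<close>

lemma Ck_on_SucI:
  assumes "open S" "\<And>x. x \<in> S \<Longrightarrow> (f has_derivative f' x) (at x)"
    and "\<And>v. Ck_on k (\<lambda>x. f' x v) S"
  shows "Ck_on (Suc k) f S"
proof -
  have "frechet_derivative f (at x) = f' x" if "x \<in> S" for x
    using frechet_derivative_at[OF assms(2)[OF that]] by simp
  then have "Ck_on k (\<lambda>x. frechet_derivative f (at x) v) S" for v
    using Ck_on_cong[OF assms(1), of "\<lambda>x. frechet_derivative f (at x) v" "\<lambda>x. f' x v" k] assms(3)
    by auto
  then show ?thesis
    using assms(2) by (auto simp: differentiable_def)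
qed

lemma Ck_on_has_derivative:
  assumes "Ck_on (Suc k) f S" "x \<in> S"
  shows "(f has_derivative frechet_derivative f (at x)) (at x)"
  using assms by (simp add: frechet_derivative_works)

lemma Ck_on_Suc_imp_Ck_on: "Ck_on (Suc k) f S \<Longrightarrow> Ck_on k f S"
proof (induction k arbitrary: f)
  case 0
  then show ?case
    by (auto intro!: continuous_at_imp_continuous_on differentiable_imp_continuous_within)
next
  case (Suc k)
  from Suc.prems have "\<forall>x\<in>S. f differentiable (at x)"
    and "Ck_on (Suc k) (\<lambda>x. frechet_derivative f (at x) v) S" for v
    unfolding Ck_on.simps(2)[of "Suc k"] by blast+
  then show ?case
    using Suc.IH by (simp only: Ck_on.simps(2)[of k]) blast
qed

lemma Ck_on_Un:
  "open S \<Longrightarrow> open T \<Longrightarrow> Ck_on k f S \<Longrightarrow> Ck_on k f T \<Longrightarrow> Ck_on k f (S \<union> T)"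
  by (induction k arbitrary: f) (auto intro: continuous_on_open_Un)

lemma Ck_on_const: "open S \<Longrightarrow> Ck_on k (\<lambda>_. c) S"
proof (induction k arbitrary: c)
  case (Suc k)
  show ?case
    by (rule Ck_on_SucI[OF Suc.prems, where f' = "\<lambda>_ _. 0"]) (auto intro: Suc)
qed simp

lemma Ck_on_add:
  "open S \<Longrightarrow> Ck_on k f S \<Longrightarrow> Ck_on k g S \<Longrightarrow> Ck_on k (\<lambda>x. f x + g x) S"
proof (induction k arbitrary: f g)
  case 0
  then show ?case by (auto intro: continuous_intros)
next
  case (Suc k)
  show ?case
  proof (rule Ck_on_SucI[OF Suc.prems(1)])
    show "((\<lambda>x. f x + g x) has_derivative
        (\<lambda>v. frechet_derivative f (at x) v + frechet_derivative g (at x) v)) (at x)"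
      if "x \<in> S" for x
      by (intro has_derivative_add Ck_on_has_derivative[OF Suc.prems(2) that]
            Ck_on_has_derivative[OF Suc.prems(3) that])
  qed (use Suc in auto)
qed

lemma Ck_on_sum:
  "open S \<Longrightarrow> (\<And>i. i \<in> I \<Longrightarrow> Ck_on k (f i) S) \<Longrightarrow> Ck_on k (\<lambda>x. \<Sum>i\<in>I. f i x) S"
  by (induction I rule: infinite_finite_induct) (auto intro: Ck_on_const Ck_on_add)

lemma Ck_on_bounded_linear:
  assumes "bounded_linear L"
  shows "open S \<Longrightarrow> Ck_on k f S \<Longrightarrow> Ck_on k (\<lambda>x. L (f x)) S"
proof (induction k arbitrary: f)
  case 0
  then show ?case by (simp add: bounded_linear.continuous_on[OF assms])
next
  case (Suc k)
  show ?case
    by (rule Ck_on_SucI[OF Suc.prems(1) bounded_linear.has_derivative[OF assms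
            Ck_on_has_derivative[OF Suc.prems(2)]]]) (use Suc in auto)
qed

lemma Ck_on_bounded_bilinear:
  assumes "bounded_bilinear B"
  shows "open S \<Longrightarrow> Ck_on k f S \<Longrightarrow> Ck_on k g S \<Longrightarrow> Ck_on k (\<lambda>x. B (f x) (g x)) S"
proof (induction k arbitrary: f g)
  case 0
  then show ?case by (simp add: bounded_bilinear.continuous_on[OF assms])
next
  case (Suc k)
  show ?case
  proof (rule Ck_on_SucI[OF Suc.prems(1)])
    show "((\<lambda>x. B (f x) (g x)) has_derivative
        (\<lambda>v. B (f x) (frechet_derivative g (at x) v) + B (frechet_derivative f (at x) v) (g x))) (at x)"
      if "x \<in> S" for x
      by (intro bounded_bilinear.FDERIV[OF assms] Ck_on_has_derivative[OF Suc.prems(2) that]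
            Ck_on_has_derivative[OF Suc.prems(3) that])
    show "Ck_on k (\<lambda>x. B (f x) (frechet_derivative g (at x) v) +
            B (frechet_derivative f (at x) v) (g x)) S" for v
      using Suc Ck_on_Suc_imp_Ck_on[OF Suc.prems(2)] Ck_on_Suc_imp_Ck_on[OF Suc.prems(3)]
      by (intro Ck_on_add Suc.IH) auto
  qed
qed

text \<open>
  The derivative \<open>Dg(f x) (Df(x) v)\<close> varies with \<open>x\<close> both in the map and in its argument.
  Expanding the argument in the basis separates the two: the terms are products of a component of
  \<open>Df(x) v\<close> and of \<open>Dg(f x) b\<close> for a fixed \<open>b\<close>, and the latter is again a composition, of lower
  order.
\<close>

lemma Ck_on_compose:
  fixes f :: "'a::euclidean_space \<Rightarrow> 'b::euclidean_space"
    and g :: "'b \<Rightarrow> 'c::real_normed_vector"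
  assumes "open S" "open T"
  shows "Ck_on k f S \<Longrightarrow> Ck_on k g T \<Longrightarrow> f ` S \<subseteq> T \<Longrightarrow> Ck_on k (\<lambda>x. g (f x)) S"
proof (induction k arbitrary: f g)
  case 0
  then show ?case by (auto intro: continuous_on_compose2)
next
  case (Suc k)
  let ?f' = "\<lambda>x. frechet_derivative f (at x)"
  let ?g' = "\<lambda>y. frechet_derivative g (at y)"
  have g': "(g has_derivative ?g' (f x)) (at (f x))" if "x \<in> S" for x
    using Ck_on_has_derivative[OF Suc.prems(2)] Suc.prems(3) that by auto
  have expand: "?g' (f x) w = (\<Sum>b\<in>Basis. (w \<bullet> b) *\<^sub>R ?g' (f x) b)" if "x \<in> S" for x w
  proof -
    have "linear (?g' (f x))"
      using g'[OF that] has_derivative_linear by blast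
    then have "?g' (f x) (\<Sum>b\<in>Basis. (w \<bullet> b) *\<^sub>R b) = (\<Sum>b\<in>Basis. (w \<bullet> b) *\<^sub>R ?g' (f x) b)"
      by (simp only: linear_sum linear_scale)
    then show ?thesis
      by (simp only: euclidean_representation)
  qed
  show ?case
  proof (rule Ck_on_SucI[OF assms(1)])
    show "((\<lambda>x. g (f x)) has_derivative (\<lambda>v. \<Sum>b\<in>Basis. (?f' x v \<bullet> b) *\<^sub>R ?g' (f x) b)) (at x)"
      if "x \<in> S" for x
      using has_derivative_compose[OF Ck_on_has_derivative[OF Suc.prems(1) that] g'[OF that]]
      by (simp only: expand[OF that, symmetric])
    have "Ck_on k (\<lambda>x. ?g' (f x) b) S" for b
      using Suc Ck_on_Suc_imp_Ck_on[OF Suc.prems(1)] by (intro Suc.IH) auto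
    moreover have "Ck_on k (\<lambda>x. ?f' x v \<bullet> b) S" for v b
      using Suc.prems by (intro Ck_on_bounded_linear[OF bounded_linear_inner_left assms(1)]) auto
    ultimately show "Ck_on k (\<lambda>x. \<Sum>b\<in>Basis. (?f' x v \<bullet> b) *\<^sub>R ?g' (f x) b) S" for v
      by (intro Ck_on_sum[OF assms(1)]
            Ck_on_bounded_bilinear[OF bounded_bilinear_scaleR assms(1)])
  qed
qed

lemma Ck_on_ident: "open S \<Longrightarrow> Ck_on k (\<lambda>x. x) S"
proof (cases k)
  case (Suc j)
  moreover assume "open S"
  ultimately show ?thesis
    by (auto intro!: Ck_on_SucI[where f' = "\<lambda>_ v. v"] Ck_on_const simp del: Ck_on.simps)
qed simp


section \<open>Bump functions\<close>

text \<open>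
  The function \<open>exp(-1/t) / t\<^sup>n\<close> for \<open>t > 0\<close>, continued by zero. Only \<open>n = 0\<close> enters the bump
  function; the whole family is needed because it is closed, up to linear combinations, under
  differentiation.
\<close>

definition flat_exp :: "nat \<Rightarrow> real \<Rightarrow> real" where
  "flat_exp n t = (if t > 0 then inverse t ^ n / exp (inverse t) else 0)"

lemma flat_exp_tendsto_0: "(flat_exp n \<longlongrightarrow> 0) (at 0)"
proof -
  have "((\<lambda>t::real. inverse t ^ n / exp (inverse t)) \<longlongrightarrow> 0) (at_right 0)"
    using filterlim_compose[OF tendsto_power_div_exp_0 filterlim_inverse_at_top_right] .
  moreover have "eventually (\<lambda>t. flat_exp n t = inverse t ^ n / exp (inverse t)) (at_right 0)"
    by (rule eventually_at_rightI[of 0 1]) (auto simp: flat_exp_def)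
  ultimately have "(flat_exp n \<longlongrightarrow> 0) (at_right 0)"
    by (simp add: tendsto_cong)
  moreover have "eventually (\<lambda>t. flat_exp n t = 0) (at_left 0)"
    by (rule eventually_at_leftI[of "-1"]) (auto simp: flat_exp_def)
  then have "(flat_exp n \<longlongrightarrow> 0) (at_left 0)"
    by (rule tendsto_eventually)
  ultimately show ?thesis
    by (simp add: filterlim_at_split)
qed

lemma flat_exp_has_derivative:
  "(flat_exp n has_field_derivative flat_exp (n + 2) t - real n * flat_exp (n + 1) t) (at t)"
proof (cases t "0::real" rule: linorder_cases)
  case less
  have "((\<lambda>_. 0) has_field_derivative flat_exp (n + 2) t - real n * flat_exp (n + 1) t) (at t)"
    using less by (simp add: flat_exp_def)
  then show ?thesis
    by (rule has_field_derivative_transform_within[where d = "- t"]) (use less in \<open>auto simp: flat_exp_def dist_real_def\<close>)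
next
  case equal
  \<comment> \<open>The difference quotient at 0 is the next member of the family, also at \<open>h = 0\<close>, where the
    quotient is 0 by the convention for division.\<close>
  have "(\<lambda>h. (flat_exp n (0 + h) - flat_exp n 0) / h) = flat_exp (n + 1)"
    by (auto simp: flat_exp_def fun_eq_iff field_simps)
  then show ?thesis
    using flat_exp_tendsto_0[of "n + 1"] equal by (simp add: DERIV_def flat_exp_def)
next
  case greater
  have pow: "((\<lambda>t. inverse t ^ n) has_field_derivative - real n * inverse t ^ (n + 1)) (at t)" for n
  proof (induction n)
    case (Suc n)
    show ?case
      using DERIV_mult[OF DERIV_inverse[of t UNIV] Suc] greater
      by (auto elim!: DERIV_cong simp: algebra_simps)
  qed simp
  have e: "((\<lambda>t. exp (- inverse t)) has_field_derivative inverse t * inverse t * exp (- inverse t)) (at t)"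
    using greater by (auto intro!: derivative_eq_intros)
  have "((\<lambda>t. inverse t ^ n * exp (- inverse t)) has_field_derivative
          flat_exp (n + 2) t - real n * flat_exp (n + 1) t) (at t)"
    using DERIV_mult[OF pow[of n] e]
    by (rule DERIV_cong) (use greater in \<open>simp add: flat_exp_def exp_minus divide_inverse algebra_simps\<close>)
  then show ?thesis
    by (rule has_field_derivative_transform_within[where d = t])
       (use greater in \<open>auto simp: flat_exp_def dist_real_def exp_minus field_simps\<close>)
qed

lemma Ck_on_flat_exp: "Ck_on k (flat_exp n) UNIV"
proof (induction k arbitrary: n)
  case 0
  show ?case
    by (auto intro!: continuous_at_imp_continuous_on DERIV_isCont[OF flat_exp_has_derivative])
next
  case (Suc k)
  show ?case
  proof (rule Ck_on_SucI[OF open_UNIV flat_exp_has_derivative[unfolded has_field_derivative_def]])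
    have "Ck_on k (\<lambda>t. v * (flat_exp (n + 2) t + (- real n) * flat_exp (n + 1) t)) UNIV" for v
      by (intro Ck_on_bounded_linear[OF bounded_linear_mult_right] Ck_on_add Suc open_UNIV)
    then show "Ck_on k (\<lambda>t. (flat_exp (n + 2) t - real n * flat_exp (n + 1) t) * v) UNIV" for v
      by (simp add: algebra_simps)
  qed
qed

lemma ex_smooth_bump:
  fixes x0 :: "'a::euclidean_space"
  assumes "r > 0"
  obtains \<phi> :: "'a \<Rightarrow> real"
  where "smooth_on \<phi> UNIV" "\<phi> x0 = 1" "\<And>x. x \<notin> cball x0 r \<Longrightarrow> \<phi> x = 0"
proof
  \<comment> \<open>The square of the distance, unlike the distance, is smooth at the centre.\<close>
  let ?u = "\<lambda>x. r\<^sup>2 + - ((x - x0) \<bullet> (x - x0))"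
  let ?\<phi> = "\<lambda>x. inverse (flat_exp 0 (r\<^sup>2)) * flat_exp 0 (?u x)"
  have "Ck_on k (\<lambda>x. x + - x0) UNIV" for k
    by (intro Ck_on_add Ck_on_ident Ck_on_const open_UNIV)
  then have "Ck_on k (\<lambda>x. (x - x0) \<bullet> (x - x0)) UNIV" for k
    by (intro Ck_on_bounded_bilinear[OF bounded_bilinear_inner]) auto
  then have "Ck_on k ?u UNIV" for k
    by (intro Ck_on_add Ck_on_const Ck_on_bounded_linear[OF bounded_linear_minus[OF bounded_linear_ident]]) auto
  then have "Ck_on k (\<lambda>x. flat_exp 0 (?u x)) UNIV" for k
    by (rule Ck_on_compose[OF open_UNIV open_UNIV _ Ck_on_flat_exp]) simp
  then have "Ck_on k ?\<phi> UNIV" for k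
    by (rule Ck_on_bounded_linear[OF bounded_linear_mult_right open_UNIV])
  then show "smooth_on ?\<phi> UNIV"
    by (simp add: smooth_on_def)
  show "?\<phi> x0 = 1"
    using assms by (simp add: flat_exp_def)
  show "?\<phi> x = 0" if "x \<notin> cball x0 r" for x
  proof -
    have "r\<^sup>2 \<le> (norm (x - x0))\<^sup>2"
      using that assms by (intro power_mono) (auto simp: dist_norm norm_minus_commute)
    then show ?thesis
      by (simp add: flat_exp_def dot_square_norm)
  qed
qed



section \<open>Tangent vectors and their components in overlapping charts\<close>

lemma chart_at:
  assumes "smooth_atlas A"
  shows chart_at_in_atlas: "chart_at A p \<in> A" and in_chart_at: "p \<in> fst (chart_at A p)"
proof -
  have "\<exists>c. c \<in> A \<and> p \<in> fst c"
    using assms unfolding smooth_atlas_def by blast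
  from someI_ex[OF this] show "chart_at A p \<in> A" "p \<in> fst (chart_at A p)"
    by (simp_all add: chart_at_def)
qed

lemma chart_inv_chart:
  "smooth_atlas A \<Longrightarrow> c \<in> A \<Longrightarrow> p \<in> fst c \<Longrightarrow> chart_inv c (snd c p) = p"
  unfolding smooth_atlas_def is_chart_def homeomorphism_def by blast

lemma chart_chart_inv:
  "smooth_atlas A \<Longrightarrow> c \<in> A \<Longrightarrow> x \<in> chart_range c \<Longrightarrow> snd c (chart_inv c x) = x"
  unfolding smooth_atlas_def is_chart_def homeomorphism_def by blast

lemma chart_inv_in:
  "smooth_atlas A \<Longrightarrow> c \<in> A \<Longrightarrow> x \<in> chart_range c \<Longrightarrow> chart_inv c x \<in> fst c"
  unfolding smooth_atlas_def is_chart_def homeomorphism_def by blast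

lemma open_chart_image:
  assumes "smooth_atlas A" "c \<in> A" "open V"
  shows "open (snd c ` (fst c \<inter> V))"
proof -
  have c: "open (fst c)" "open (chart_range c)"
      "homeomorphism (fst c) (chart_range c) (snd c) (chart_inv c)"
    using assms unfolding smooth_atlas_def is_chart_def by auto
  have "openin (top_of_set (chart_range c)) (snd c ` (fst c \<inter> V))"
    by (rule homeomorphism_imp_open_map[OF c(3)]) (use assms(3) c(1) in auto)
  then show ?thesis
    using c(2) openin_open_eq by blast
qed

lemma smooth_transition:
  "smooth_atlas A \<Longrightarrow> c \<in> A \<Longrightarrow> d \<in> A \<Longrightarrow>
    smooth_on (snd d \<circ> chart_inv c) (snd c ` (fst c \<inter> fst d))"
  by (auto simp: smooth_atlas_def)

text \<open>
  The components in the chart \<open>d\<close> of the tangent vector at \<open>p\<close> with components \<open>v\<close> in the chart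
  \<open>c\<close>. Keeping the source chart as a parameter makes the transformation law for three charts
  expressible; \<open>components_in\<close> fixes it to the chosen chart at \<open>p\<close>.
\<close>

definition change_components ::
  "('m, 'a::euclidean_space) chart \<Rightarrow> ('m, 'a) chart \<Rightarrow> 'm \<Rightarrow> 'a \<Rightarrow> 'a" where
  "change_components c d p v = frechet_derivative (snd d \<circ> chart_inv c) (at (snd c p)) v"

lemma components_in_eq: "components_in A c p = change_components (chart_at A p) c p"
  by (simp add: components_in_def change_components_def fun_eq_iff)

lemma transition_has_derivative:
  assumes "smooth_atlas A" "c \<in> A" "d \<in> A" "p \<in> fst c" "p \<in> fst d"
  shows "((snd d \<circ> chart_inv c) has_derivative change_components c d p) (at (snd c p))"
proof -
  have "Ck_on (Suc 0) (snd d \<circ> chart_inv c) (snd c ` (fst c \<inter> fst d))"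
    using smooth_transition[OF assms(1-3)] unfolding smooth_on_def by blast
  moreover have "snd c p \<in> snd c ` (fst c \<inter> fst d)"
    using assms(4,5) by blast
  ultimately show ?thesis
    unfolding change_components_def by (rule Ck_on_has_derivative)
qed

lemma linear_change_components:
  "smooth_atlas A \<Longrightarrow> c \<in> A \<Longrightarrow> d \<in> A \<Longrightarrow> p \<in> fst c \<Longrightarrow> p \<in> fst d \<Longrightarrow>
    linear (change_components c d p)"
  using transition_has_derivative has_derivative_linear by blast

lemma linear_components_in:
  "smooth_atlas A \<Longrightarrow> c \<in> A \<Longrightarrow> p \<in> fst c \<Longrightarrow> linear (components_in A c p)"
  by (simp add: components_in_eq linear_change_components chart_at)

lemma change_components_self:
  assumes "smooth_atlas A" "c \<in> A" "p \<in> fst c"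
  shows "change_components c c p v = v"
proof -
  have "frechet_derivative (snd c \<circ> chart_inv c) (at (snd c p)) =
        frechet_derivative (\<lambda>x. x) (at (snd c p))"
  proof (rule frechet_derivative_cong_open)
    show "open (chart_range c)"
      using assms by (auto simp: smooth_atlas_def is_chart_def)
    show "snd c p \<in> chart_range c"
      using assms(3) by (simp add: chart_range_def)
  qed (simp add: chart_chart_inv[OF assms(1,2)])
  then show ?thesis
    by (simp add: change_components_def)
qed

lemma change_components_trans:
  assumes "smooth_atlas A" "c \<in> A" "d \<in> A" "e \<in> A" "p \<in> fst c" "p \<in> fst d" "p \<in> fst e"
  shows "change_components d e p (change_components c d p v) = change_components c e p v"
proof -
  let ?S = "snd c ` (fst c \<inter> fst d)"
  have "(snd d \<circ> chart_inv c) (snd c p) = snd d p"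
    using assms by (simp add: chart_inv_chart)
  then have "((snd e \<circ> chart_inv d) \<circ> (snd d \<circ> chart_inv c) has_derivative
      change_components d e p \<circ> change_components c d p) (at (snd c p))"
    using assms by (intro diff_chain_at) (simp_all add: transition_has_derivative del: o_apply)
  moreover have "open ?S"
    using assms by (auto intro: open_chart_image simp: smooth_atlas_def is_chart_def)
  moreover have "((snd e \<circ> chart_inv d) \<circ> (snd d \<circ> chart_inv c)) x = (snd e \<circ> chart_inv c) x"
    if "x \<in> ?S" for x
    using that assms by (auto simp: chart_inv_chart)
  ultimately have "((snd e \<circ> chart_inv c) has_derivative
      change_components d e p \<circ> change_components c d p) (at (snd c p))"
    using has_derivative_transform_within_open[of _ _ "snd c p" UNIV ?S] assms(5,6) by blast
  from frechet_derivative_at[OF this] show ?thesis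
    unfolding change_components_def[of c e] by (metis comp_apply)
qed


section \<open>Vector fields and smooth functions\<close>

lemma vector_field_linear_combination:
  assumes "smooth_atlas A" "vector_field A E" "vector_field A F"
  shows "vector_field A (\<lambda>p. s *\<^sub>R E p + t *\<^sub>R F p)"
  unfolding vector_field_def smooth_on_def
proof (intro ballI allI)
  fix c k assume c: "c \<in> A"
  let ?S = "chart_range c"
  have S: "open ?S"
    using assms(1) c by (auto simp: smooth_atlas_def is_chart_def)
  have rep: "local_rep A c (\<lambda>p. s *\<^sub>R E p + t *\<^sub>R F p) x =
      s *\<^sub>R local_rep A c E x + t *\<^sub>R local_rep A c F x" if "x \<in> ?S" for x
    using linear_components_in[OF assms(1) c chart_inv_in[OF assms(1) c that]]
    by (simp add: local_rep_def linear_add linear_scale)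
  have "Ck_on k (\<lambda>x. s *\<^sub>R local_rep A c E x + t *\<^sub>R local_rep A c F x) ?S"
    using assms(2,3) c S unfolding vector_field_def smooth_on_def
    by (intro Ck_on_add Ck_on_bounded_linear[OF bounded_linear_scaleR_right]) auto
  then show "Ck_on k (local_rep A c (\<lambda>p. s *\<^sub>R E p + t *\<^sub>R F p)) ?S"
    by (subst Ck_on_cong[OF S rep])
qed

text \<open>
  The continuous dependence of \<open>P\<close> on the point will be read off from this, applied to functions of
  the form \<open>g(P E, G)\<close>.
\<close>

lemma smooth_function_continuous:
  assumes "smooth_atlas A" "smooth_function A f"
  shows "continuous_on UNIV f"
proof -
  have "continuous_on (fst c) f" if c: "c \<in> A" for c
  proof -
    have "continuous_on (chart_range c) (f \<circ> chart_inv c)"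
      using assms(2) c unfolding smooth_function_def smooth_on_def by (metis Ck_on.simps(1))
    moreover have "continuous_on (fst c) (snd c)"
      using assms(1) c unfolding smooth_atlas_def is_chart_def homeomorphism_def by auto
    ultimately have "continuous_on (fst c) ((f \<circ> chart_inv c) \<circ> snd c)"
      unfolding chart_range_def by (rule continuous_on_compose[rotated])
    then show ?thesis
      using chart_inv_chart[OF assms(1) c] by (simp cong: continuous_on_cong)
  qed
  moreover have "\<And>c. c \<in> A \<Longrightarrow> open (fst c)" "(\<Union>c\<in>A. fst c) = UNIV"
    using assms(1) by (auto simp: smooth_atlas_def is_chart_def)
  ultimately show ?thesis
    using continuous_on_open_UN[of A fst f] by simp
qed

text \<open>
  In one chart around \<open>p\<close>, multiply the constant field \<open>v\<close> by a bump function whose support lies in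
  a closed ball inside the chart range, and extend by zero. The preimage \<open>K\<close> of the ball is compact,
  hence closed because the manifold is Hausdorff, so the chart domain and the complement of \<open>K\<close> are
  an open cover. On the first set the field has smooth components in any chart by the chain rule,
  on the second it vanishes.
\<close>

lemma ex_vector_field_through:
  fixes A :: "('m::{t2_space,second_countable_topology}, 'a::euclidean_space) chart set"
  assumes A: "smooth_atlas A"
  obtains E where "vector_field A E" "E p = v"
proof -
  define c0 where "c0 = chart_at A p"
  have c0: "c0 \<in> A" and p: "p \<in> fst c0"
    by (simp_all add: c0_def chart_at[OF A])
  have op: "open (fst c)" "open (chart_range c)" if "c \<in> A" for c
    using that A by (auto simp: smooth_atlas_def is_chart_def)
  obtain r where r: "r > 0" "cball (snd c0 p) r \<subseteq> chart_range c0"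
    using op(2)[OF c0] p unfolding open_contains_cball chart_range_def by blast
  obtain \<phi> :: "'a \<Rightarrow> real" where \<phi>: "smooth_on \<phi> UNIV" "\<phi> (snd c0 p) = 1"
      "\<And>x. x \<notin> cball (snd c0 p) r \<Longrightarrow> \<phi> x = 0"
    using ex_smooth_bump[OF r(1)] by metis
  define K where "K = chart_inv c0 ` cball (snd c0 p) r"
  have "continuous_on (cball (snd c0 p) r) (chart_inv c0)"
    using A c0 r(2) unfolding smooth_atlas_def is_chart_def homeomorphism_def
    by (blast intro: continuous_on_subset)
  then have "closed K"
    unfolding K_def by (intro compact_imp_closed compact_continuous_image compact_cball)
  \<comment> \<open>Tangent vectors at \<open>q\<close> are recorded in the chart chosen at \<open>q\<close>, so the constant components \<open>v\<close>
    in \<open>c0\<close> have to be transformed to that chart.\<close>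
  define E where "E = (\<lambda>q. if q \<in> fst c0
      then \<phi> (snd c0 q) *\<^sub>R change_components c0 (chart_at A q) q v else 0)"
  have "vector_field A E"
    unfolding vector_field_def smooth_on_def
  proof (intro ballI allI)
    fix c k assume c: "c \<in> A"
    let ?S = "snd c ` (fst c \<inter> fst c0)" and ?T = "snd c ` (fst c \<inter> - K)"
    let ?V = "snd c0 ` (fst c0 \<inter> fst c)"
    have opens: "open ?S" "open ?T" "open ?V"
      using open_chart_image[OF A c] open_chart_image[OF A c0] op c c0 \<open>closed K\<close> by auto
    let ?\<tau> = "snd c0 \<circ> chart_inv c"
    have \<tau>: "Ck_on k ?\<tau> ?S" "?\<tau> ` ?S \<subseteq> ?V"
      using smooth_transition[OF A c c0] by (auto simp: smooth_on_def chart_inv_chart[OF A c])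
    have "Ck_on k (\<lambda>y. frechet_derivative (snd c \<circ> chart_inv c0) (at y) v) ?V"
      using smooth_transition[OF A c0 c] unfolding smooth_on_def by (metis Ck_on.simps(2))
    from Ck_on_compose[OF opens(1,3) \<tau>(1) this \<tau>(2)]
    have coord: "Ck_on k (\<lambda>x. frechet_derivative (snd c \<circ> chart_inv c0) (at (?\<tau> x)) v) ?S" .
    have bump: "Ck_on k (\<lambda>x. \<phi> (?\<tau> x)) ?S"
      using Ck_on_compose[OF opens(1) open_UNIV \<tau>(1), of \<phi>] \<phi>(1) by (simp add: smooth_on_def)
    let ?e = "\<lambda>x. \<phi> (?\<tau> x) *\<^sub>R
        frechet_derivative (snd c \<circ> chart_inv c0) (at (?\<tau> x)) v"
    have e: "Ck_on k ?e ?S"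
      by (rule Ck_on_bounded_bilinear[OF bounded_bilinear_scaleR opens(1) bump coord])
    have rep_e: "local_rep A c E x = ?e x" if "x \<in> ?S" for x
    proof -
      from that obtain q where q: "q \<in> fst c" "q \<in> fst c0" "x = snd c q" by auto
      have "local_rep A c E x = \<phi> (snd c0 q) *\<^sub>R
          change_components (chart_at A q) c q (change_components c0 (chart_at A q) q v)"
        using q linear_change_components[OF A chart_at_in_atlas[OF A] c in_chart_at[OF A] q(1)]
        by (simp add: local_rep_def chart_inv_chart[OF A c] components_in_eq E_def linear_scale)
      also have "\<dots> = \<phi> (snd c0 q) *\<^sub>R change_components c0 c q v"
        using change_components_trans[OF A c0 chart_at_in_atlas[OF A] c q(2) in_chart_at[OF A] q(1)]
        by simp
      finally show ?thesis
        using q by (simp add: change_components_def chart_inv_chart[OF A c])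
    qed
    have "Ck_on k (local_rep A c E) ?S \<longleftrightarrow> Ck_on k ?e ?S"
      by (rule Ck_on_cong[OF opens(1)]) (rule rep_e)
    with e have smooth_S: "Ck_on k (local_rep A c E) ?S" by (simp only:)
    have rep_0: "local_rep A c E x = 0" if "x \<in> ?T" for x
    proof -
      from that obtain q where q: "q \<in> fst c" "q \<notin> K" "x = snd c q" by auto
      have "E q = 0"
      proof (cases "q \<in> fst c0")
        case True
        then have "snd c0 q \<notin> cball (snd c0 p) r"
          using q(2) chart_inv_chart[OF A c0 True] by (metis K_def imageI)
        then show ?thesis by (simp add: E_def \<phi>(3))
      qed (simp add: E_def)
      then show ?thesis
        using q linear_0[OF linear_components_in[OF A c q(1)]]
        by (simp add: local_rep_def chart_inv_chart[OF A c])
    qed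
    have "Ck_on k (local_rep A c E) ?T \<longleftrightarrow> Ck_on k (\<lambda>_. 0::'a) ?T"
      by (rule Ck_on_cong[OF opens(2)]) (rule rep_0)
    with Ck_on_const[OF opens(2)] have smooth_T: "Ck_on k (local_rep A c E) ?T" by (simp only:)
    have "chart_range c = ?S \<union> ?T"
    proof -
      have "K \<subseteq> fst c0"
        using r(2) chart_inv_in[OF A c0] by (auto simp: K_def)
      then show ?thesis by (auto simp: chart_range_def)
    qed
    then show "Ck_on k (local_rep A c E) (chart_range c)"
      using Ck_on_Un[OF opens(1,2) smooth_S smooth_T] by simp
  qed
  moreover have "E p = v"
    using p \<phi>(2) change_components_self[OF A c0 p] by (simp add: E_def flip: c0_def)
  ultimately show thesis by (rule that)
qed


section \<open>Parallel tensor fields and curvature\<close>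

text \<open>
  The absence of torsion expresses the bracket through the connection, which preserves smoothness by
  definition; no second derivatives of transition maps have to be computed.
\<close>

lemma vector_field_lie_bracket:
  assumes "smooth_atlas A" "affine_connection A D" "torsion_free A D"
    and "vector_field A E" "vector_field A F"
  shows "vector_field A (lie_bracket A E F)"
proof -
  have "lie_bracket A E F = (\<lambda>p. 1 *\<^sub>R D E F p + (- 1) *\<^sub>R D F E p)"
    using assms(3-5) unfolding torsion_free_def by (simp add: fun_eq_iff)
  moreover have "vector_field A (D E F)" "vector_field A (D F E)"
    using assms(2,4,5) by (auto simp: affine_connection_def)
  ultimately show ?thesis
    using vector_field_linear_combination[OF assms(1)] by metis
qed

text \<open>
  \<open>\<nabla>P = 0\<close> lets \<open>P\<close> be pulled out of each of the three terms of the curvature. In the first two it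
  is used twice, the second time for the vector fields \<open>D F G\<close> and \<open>D E G\<close>; in the third it is used
  along the bracket, which therefore has to be a vector field.
\<close>

lemma curvature_commutes_with_parallel:
  assumes "smooth_atlas A" and D: "affine_connection A D" and "torsion_free A D"
    and P: "tensor_field_11 A P" and par: "parallel_11 A D P"
    and E: "vector_field A E" and F: "vector_field A F" and G: "vector_field A G"
  shows "curvature A D E F (\<lambda>q. P q (G q)) p = P p (curvature A D E F G p)"
proof -
  have step: "D X (\<lambda>q. P q (Y q)) = (\<lambda>q. P q (D X Y q))"
    if "vector_field A X" "vector_field A Y" for X Y
    using par that by (simp add: parallel_11_def cov_deriv_11_def fun_eq_iff)
  have DXY: "vector_field A (D X Y)" if "vector_field A X" "vector_field A Y" for X Y
    using D that by (auto simp: affine_connection_def)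
  have bracket: "vector_field A (lie_bracket A E F)"
    by (rule vector_field_lie_bracket[OF assms(1) D assms(3) E F])
  have "linear (P p)"
    using P by (simp add: tensor_field_11_def)
  then show ?thesis
    by (simp add: curvature_def step[OF E G] step[OF F G] step[OF bracket G]
        step[OF E DXY[OF F G]] step[OF F DXY[OF E G]] linear_diff)
qed

text \<open>
  The commutation of \<open>P\<close> with the curvature at \<open>p\<close>, evaluated on vector fields with the prescribed
  values \<open>u\<close>, \<open>v\<close>, \<open>w\<close> at \<open>p\<close> and divided by \<open>k\<close>.
\<close>

lemma kurose_parallel_pointwise:
  assumes A: "smooth_atlas A" and D: "affine_connection A D" and T: "torsion_free A D"
    and P: "tensor_field_11 A P" and par: "parallel_11 A D P"
    and k: "\<forall>E F G. vector_field A E \<longrightarrow> vector_field A F \<longrightarrow> vector_field A G \<longrightarrow>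
      (\<forall>p. curvature A D E F G p = k *\<^sub>R (g p (F p) (G p) *\<^sub>R E p - g p (E p) (G p) *\<^sub>R F p))"
    and "k \<noteq> 0"
  shows "g p v (P p w) *\<^sub>R u - g p u (P p w) *\<^sub>R v = g p v w *\<^sub>R P p u - g p u w *\<^sub>R P p v"
proof -
  obtain E where E: "vector_field A E" "E p = u"
    by (rule ex_vector_field_through[OF A])
  obtain F where F: "vector_field A F" "F p = v"
    by (rule ex_vector_field_through[OF A])
  obtain G where G: "vector_field A G" "G p = w"
    by (rule ex_vector_field_through[OF A])
  have PG: "vector_field A (\<lambda>q. P q (G q))"
    using P G by (simp add: tensor_field_11_def)
  have lin: "linear (P p)"
    using P by (simp add: tensor_field_11_def)
  have R: "curvature A D E F H p = k *\<^sub>R (g p v (H p) *\<^sub>R u - g p u (H p) *\<^sub>R v)"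
    if "vector_field A H" for H
    using k[rule_format, OF E(1) F(1) that, of p] unfolding E(2) F(2) .
  have "k *\<^sub>R (g p v (P p w) *\<^sub>R u - g p u (P p w) *\<^sub>R v) =
      k *\<^sub>R (g p v w *\<^sub>R P p u - g p u w *\<^sub>R P p v)"
    using curvature_commutes_with_parallel[OF A D T P par E(1) F(1) G(1), of p]
    unfolding R[OF PG] R[OF G(1)] G(2) by (simp only: linear_diff[OF lin] linear_scale[OF lin])
  then show ?thesis
    using \<open>k \<noteq> 0\<close> by (simp only: scaleR_cancel_left) simp
qed


section \<open>Involutions compatible with a constant curvature tensor\<close>

text \<open>
  Both eigenspaces of \<open>J\<close> are nonzero, and they span the space because
  \<open>2 v = (v + J v) + (v - J v)\<close>. The identity \<open>key\<close> makes each of them a line, as follows. For \<open>x\<close> in the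
  \<open>1\<close>-eigenspace and \<open>y\<close> in the \<open>-1\<close>-eigenspace, comparing coefficients in \<open>key\<close> gives
  \<open>b y (J w) = b y w\<close> and \<open>b x (J w) = - b x w\<close>. With this, \<open>key\<close> for two vectors of the same
  eigenspace becomes \<open>b v w u = b u w v\<close>, and they are proportional as soon as some \<open>w\<close> has
  \<open>b u w \<noteq> 0\<close>.
\<close>

lemma involution_identity_imp_dim_2:
  fixes b :: "'a::euclidean_space \<Rightarrow> 'a \<Rightarrow> real" and J :: "'a \<Rightarrow> 'a"
  assumes "linear J" and inv: "\<And>v. J (J v) = v"
    and nid: "\<exists>v. J v \<noteq> v" and nmid: "\<exists>v. J v \<noteq> - v"
    and nondeg: "\<And>v. (\<And>w. b v w = 0) \<Longrightarrow> v = 0"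
    and key: "\<And>u v w. b v (J w) *\<^sub>R u - b u (J w) *\<^sub>R v = b v w *\<^sub>R J u - b u w *\<^sub>R J v"
  shows "DIM('a) = 2"
proof -
  interpret linear J by fact
  obtain e where e: "e \<noteq> 0" "J e = e"
  proof -
    obtain v where "J v \<noteq> - v" using nmid by blast
    moreover have "J (v + J v) = v + J v" by (simp add: add inv)
    ultimately show ?thesis using that[of "v + J v"] by (metis add.commute add_eq_0_iff)
  qed
  obtain f where f: "f \<noteq> 0" "J f = - f"
  proof -
    obtain v where "J v \<noteq> v" using nid by blast
    moreover have "J (v - J v) = - (v - J v)" by (simp add: diff inv)
    ultimately show ?thesis using that[of "v - J v"] by auto
  qed
  have indep: "s = 0 \<and> t = 0"
    if "s *\<^sub>R x = t *\<^sub>R y" "x \<noteq> 0" "J x = x" "y \<noteq> 0" "J y = - y" for s t x y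
  proof -
    have "s *\<^sub>R x = J (s *\<^sub>R x)" using that(3) by (simp add: scale)
    also have "\<dots> = - (t *\<^sub>R y)" using that(5) by (simp add: that(1) scale)
    finally have "s *\<^sub>R x + s *\<^sub>R x = 0" using that(1) by (metis add.left_inverse)
    then have "s *\<^sub>R x = 0" by (simp flip: scaleR_2)
    then show ?thesis using that by simp
  qed
  have mixed: "b y (J w) = b y w \<and> b x (J w) = - b x w"
    if "x \<noteq> 0" "J x = x" "y \<noteq> 0" "J y = - y" for x y w
  proof -
    have "(b y (J w) - b y w) *\<^sub>R x = (b x (J w) + b x w) *\<^sub>R y"
      using key[of y w x] that by (simp add: algebra_simps)
    from indep[OF this that] show ?thesis by auto
  qed
  have plus: "\<exists>t. x = t *\<^sub>R e" if "J x = x" for x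
  proof (cases "x = 0")
    case False
    obtain w where w: "b e w \<noteq> 0" using nondeg e(1) by blast
    have "2 *\<^sub>R (b x w *\<^sub>R e) = 2 *\<^sub>R (b e w *\<^sub>R x)"
      using key[of x w e] mixed[OF e f, of w] mixed[OF False that f, of w] that e
      by (simp add: algebra_simps flip: scaleR_2)
    then have "b x w *\<^sub>R e = b e w *\<^sub>R x"
      by (simp only: scaleR_cancel_left) simp
    then have "x = (b x w / b e w) *\<^sub>R e"
      using w by (metis divide_inverse_commute scaleR_scaleR right_inverse scaleR_one mult.commute)
    then show ?thesis by blast
  qed (auto intro: exI[of _ 0])
  have minus: "\<exists>t. y = t *\<^sub>R f" if "J y = - y" for y
  proof (cases "y = 0")
    case False
    obtain w where w: "b f w \<noteq> 0" using nondeg f(1) by blast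
    have "2 *\<^sub>R (b y w *\<^sub>R f) = 2 *\<^sub>R (b f w *\<^sub>R y)"
      using key[of y w f] mixed[OF e f, of w] mixed[OF e False that, of w] that f
      by (simp add: algebra_simps flip: scaleR_2)
    then have "b y w *\<^sub>R f = b f w *\<^sub>R y"
      by (simp only: scaleR_cancel_left) simp
    then have "y = (b y w / b f w) *\<^sub>R f"
      using w by (metis divide_inverse_commute scaleR_scaleR right_inverse scaleR_one mult.commute)
    then show ?thesis by blast
  qed (auto intro: exI[of _ 0])
  have "v \<in> span {e, f}" for v
  proof -
    have "J (v + J v) = v + J v" "J (v - J v) = - (v - J v)" by (simp_all add: add diff inv)
    then obtain s t where "v + J v = s *\<^sub>R e" "v - J v = t *\<^sub>R f"
      using plus minus by meson
    moreover have "v = (1/2) *\<^sub>R ((v + J v) + (v - J v))" by (simp flip: scaleR_2)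
    ultimately show ?thesis
      by (metis insertI1 insertI2 span_add span_base span_scale)
  qed
  moreover have "e \<noteq> f"
    using indep[of 1 e 1 f] e f by auto
  moreover have "independent {e, f}"
  proof -
    have "e \<notin> span {f}"
      using indep[of 1 e _ f] e f by (auto simp: span_singleton)
    then show ?thesis
      using f by (simp add: independent_insert \<open>e \<noteq> f\<close>)
  qed
  ultimately show ?thesis
    using dim_eq_card[of "{e,f}" UNIV] by (auto simp: numeral_2_eq_2)
qed


section \<open>Constancy of a pointwise trivial involution, and the conclusion\<close>

text \<open>
  If \<open>P\<close> is \<open>Id\<close> or \<open>-Id\<close> at every point, then \<open>P = s Id\<close> for a sign \<open>s\<close>. Near a point \<open>p\<close> choose
  vector fields with \<open>g(E, G) \<noteq> 0\<close> at \<open>p\<close>; there \<open>s = g(P E, G) / g(E, G)\<close> is a quotient of smooth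
  functions. So \<open>s\<close> is continuous with values \<open>1\<close> and \<open>-1\<close>, and constant on connected sets.
\<close>

lemma almost_product_nontrivial_somewhere:
  assumes A: "smooth_atlas A" and g: "semi_riemannian_metric A g"
    and P: "almost_product_structure A P"
  shows "\<exists>p. (\<exists>v. P p v \<noteq> v) \<and> (\<exists>v. P p v \<noteq> - v)"
proof (rule ccontr)
  assume "\<not> ?thesis"
  then have alt: "(\<forall>v. P p v = v) \<or> (\<forall>v. P p v = - v)" for p by blast
  obtain C where C: "C \<in> components (UNIV :: 'a set)"
    "\<not> (\<forall>p\<in>C. \<forall>v. P p v = v)" "\<not> (\<forall>p\<in>C. \<forall>v. P p v = - v)"
    using P unfolding almost_product_structure_def by blast
  define s :: "'a \<Rightarrow> real" where "s p = (if \<forall>v. P p v = v then 1 else - 1)" for p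
  have Ps: "P p v = s p *\<^sub>R v" for p v
    using alt[of p] by (auto simp: s_def)
  have tensor: "tensor_field_11 A P" "tensor_field_02 A g"
    using P g by (auto simp: almost_product_structure_def semi_riemannian_metric_def)
  have "isCont s p" for p
  proof -
    obtain u :: 'b where "u \<noteq> 0" using nonempty_Basis nonzero_Basis by blast
    then obtain w where uw: "g p u w \<noteq> 0"
      using g unfolding semi_riemannian_metric_def by blast
    obtain E where E: "vector_field A E" "E p = u"
      by (rule ex_vector_field_through[OF A])
    obtain G where G: "vector_field A G" "G p = w"
      by (rule ex_vector_field_through[OF A])
    define f where "f q = g q (E q) (G q)" for q
    define h where "h q = g q (P q (E q)) (G q)" for q
    have "smooth_function A f" "smooth_function A h"
      using tensor E G unfolding f_def h_def tensor_field_11_def tensor_field_02_def by auto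
    then have cont: "isCont f q" "isCont h q" for q
      using smooth_function_continuous[OF A] continuous_on_eq_continuous_at[OF open_UNIV] by blast+
    have hs: "h q = s q * f q" for q
      using tensor(2) unfolding h_def f_def Ps tensor_field_02_def by (simp add: bilinear_lmul)
    have "f p \<noteq> 0" using uw E G by (simp add: f_def)
    then have "isCont (\<lambda>q. h q / f q) p" using cont by (intro continuous_intros) auto
    moreover have "open {q. f q \<noteq> 0}"
      using open_Collect_neq[of f "\<lambda>_. 0"] cont continuous_on_eq_continuous_at[OF open_UNIV]
      by (auto simp: continuous_at_imp_continuous_on)
    then have "eventually (\<lambda>q. f q \<noteq> 0) (nhds p)"
      using \<open>f p \<noteq> 0\<close> eventually_nhds by blast
    then have "eventually (\<lambda>q. h q / f q = s q) (nhds p)"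
      by eventually_elim (simp add: hs)
    ultimately show "isCont s p"
      using isCont_cong[of "\<lambda>q. h q / f q" s p] by simp
  qed
  then have "continuous_on C s" by (simp add: continuous_at_imp_continuous_on)
  moreover have "finite (s ` C)"
    by (rule finite_subset[of _ "{1, -1}"]) (auto simp: s_def)
  moreover have "connected C" using C(1) by (rule in_components_connected)
  ultimately have "s constant_on C"
    using continuous_finite_range_constant by blast
  then obtain t where t: "\<And>p. p \<in> C \<Longrightarrow> s p = t"
    unfolding constant_on_def by blast
  obtain p where "p \<in> C" "s p \<noteq> 1"
    using C(2) by (metis Ps scaleR_one)
  moreover obtain q where "q \<in> C" "s q \<noteq> - 1"
    using C(3) by (metis Ps scaleR_minus1_left)
  moreover have "s p = 1 \<or> s p = - 1"
    by (simp add: s_def)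
  ultimately show False using t by metis
qed

theorem theorem3p7:
  fixes A :: "('m::{t2_space,second_countable_topology}, 'a::euclidean_space) chart set"
    and D :: "('m \<Rightarrow> 'a) \<Rightarrow> ('m \<Rightarrow> 'a) \<Rightarrow> 'm \<Rightarrow> 'a"
    and P :: "'m \<Rightarrow> 'a \<Rightarrow> 'a"
    and g :: "'m \<Rightarrow> 'a \<Rightarrow> 'a \<Rightarrow> real"
  assumes "para_kaehler_like_statistical_manifold A D P g"
    and "DIM('a) \<noteq> 2"
    and "kurose_constant_curvature A D g"
  shows "hessian_structure A D g"
proof -
  have A: "smooth_atlas A" and g: "semi_riemannian_metric A g"
    and P: "almost_product_structure A P" and S: "statistical_structure A D g"
    and par: "parallel_11 A D P"
    using assms(1) unfolding para_kaehler_like_statistical_manifold_def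
      almost_para_hermitian_like_manifold_def semi_riemannian_manifold_def by auto
  have D: "affine_connection A D" "torsion_free A D"
    using S by (auto simp: statistical_structure_def)
  have P': "tensor_field_11 A P" "\<And>p v. P p (P p v) = v"
    using P by (auto simp: almost_product_structure_def)
  obtain k where k: "\<forall>E F G. vector_field A E \<longrightarrow> vector_field A F \<longrightarrow> vector_field A G \<longrightarrow>
      (\<forall>p. curvature A D E F G p = k *\<^sub>R (g p (F p) (G p) *\<^sub>R E p - g p (E p) (G p) *\<^sub>R F p))"
    using assms(3) unfolding kurose_constant_curvature_def by blast
  have "k = 0"
  proof (rule ccontr)
    assume "k \<noteq> 0"
    obtain p where p: "\<exists>v. P p v \<noteq> v" "\<exists>v. P p v \<noteq> - v"
      using almost_product_nontrivial_somewhere[OF A g P] by blast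
    have "DIM('a) = 2"
    proof (rule involution_identity_imp_dim_2[OF _ P'(2) p])
      show "linear (P p)" using P'(1) by (simp add: tensor_field_11_def)
      show "v = 0" if "\<And>w. g p v w = 0" for v
        using g that unfolding semi_riemannian_metric_def by blast
    qed (rule kurose_parallel_pointwise[OF A D P'(1) par k \<open>k \<noteq> 0\<close>])
    then show False using assms(2) by simp
  qed
  then have "flat A D"
    using k by (simp add: flat_def)
  then show ?thesis
    using S by (simp add: hessian_structure_def)
qed

end
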